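(* Let $p$ be an odd prime and let $\mathcal{P}$ be an integral point set over $\mathbb{E}_p^2$. Then all non-degenerate triangles of $\mathcal{P}$ have the same characteristic; i.e. if $\{v_1,v_2,v_3\}$ and $\{v_1',v_2',v_3'\}$ are two triples of points of $\mathcal{P}$ with side lengths $a,b,c$ and $a',b',c'$ respectively and $V^2\neq 0$, $V'^2\neq 0$, then either both $V^2$ and $V'^2$ are quadratic residues in $\mathbb{Z}_p$ or neither is.
   Context: Let $p$ be an odd prime, $\mathbb{Z}_p=\mathbb{Z}/p\mathbb{Z}$, $\alpha(p)$ the smallest quadratic non-residue modulo $p$, and $K=\mathbb{Z}_p(\sqrt{\alpha(p)})$ the quadratic extension field. Following the paper, $\mathbb{E}_p^2$ is modelled by $K^2$ with coordinates of the form $x$ or $y\sqrt{\alpha(p)}$ with $x,y\in\mathbb{Z}_p$ arising, and an integral point set over $\mathbb{E}_p^2$ is a set of points of $K^2$ such that for any two distinct points $(x_1,y_1),(x_2,y_2)$ there is $d\in\mathbb{Z}_p\setminus\{0\}$ (the side length or distance) with $(x_1-x_2)^2+(y_1-y_2)^2=d^2$. For three points with side lengths $a,b,c\in\mathbb{Z}_p$, put $V^2=(a+b+c)(a+b-c)(a-b+c)(-a+b+c)\in\mathbb{Z}_p$ (it depends only on $a^2,b^2,c^2$); the triangle is non-degenerate if $V^2\neq 0$, and then its characteristic is $1$ if $V^2$ is a quadratic residue in $\mathbb{Z}_p$ and $\alpha(p)$ otherwise. *)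

theory Defs
  imports "Berlekamp_Zassenhaus.Finite_Field"
begin

text \<open>
  The field of integers modulo \<open>p\<close> is \<open>'p mod_ring\<close>, where the cardinality of the type
  \<open>'p\<close> is the odd prime \<open>p\<close>.
\<close>

class odd_prime_card = prime_card +
  assumes odd_card: "odd CARD('a)"

instance Enum.finite_3 :: odd_prime_card
proof
  have "CARD(Enum.finite_3) = 3" by (simp add: UNIV_finite_3)
  thus "prime CARD(Enum.finite_3)" "odd CARD(Enum.finite_3)" by simp_all
qed

definition quad_res :: "'p::odd_prime_card mod_ring \<Rightarrow> bool" where
  "quad_res x \<longleftrightarrow> QuadRes (int CARD('p)) (to_int_mod_ring x)"

definition least_nonresidue :: "nat \<Rightarrow> nat" where
  "least_nonresidue p = (LEAST n. \<not> QuadRes (int p) (int n))"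

lemma QuadRes_of_nat_iff:
  "QuadRes (int CARD('p::odd_prime_card)) (int n) \<longleftrightarrow> (\<exists>y::'p mod_ring. y\<^sup>2 = of_nat n)"
proof
  assume "QuadRes (int CARD('p)) (int n)"
  then obtain y where "[y\<^sup>2 = int n] (mod int CARD('p))" by (auto simp: QuadRes_def)
  hence "(of_int (y\<^sup>2) :: 'p mod_ring) = of_int (int n)"
    by (simp only: cong_def, transfer, simp)
  thus "\<exists>y::'p mod_ring. y\<^sup>2 = of_nat n" by (metis of_int_of_nat_eq of_int_power)
next
  assume "\<exists>y::'p mod_ring. y\<^sup>2 = of_nat n"
  then obtain y :: "'p mod_ring" where y: "y\<^sup>2 = of_nat n" by blast
  hence "to_int_mod_ring (y * y) = to_int_mod_ring (of_nat n :: 'p mod_ring)"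
    by (simp add: power2_eq_square)
  hence "[(to_int_mod_ring y)\<^sup>2 = int n] (mod int CARD('p))"
    by (simp add: cong_def power2_eq_square to_int_mod_ring_mult of_nat_of_int_mod_ring,
        transfer, simp)
  thus "QuadRes (int CARD('p)) (int n)" by (auto simp: QuadRes_def)
qed

lemma quad_res_iff: "quad_res (x::'p::odd_prime_card mod_ring) \<longleftrightarrow> (\<exists>y. y\<^sup>2 = x)"
proof -
  obtain n where n: "n < CARD('p)" "x = of_nat n" using surj_of_nat_mod_ring by blast
  hence "to_int_mod_ring x = int n" by (simp add: of_nat_of_int_mod_ring)
  thus ?thesis using QuadRes_of_nat_iff[of n, where ?'p = 'p] n by (simp add: quad_res_def)
qed

lemma one_neq_minus_one: "(1::'p::odd_prime_card mod_ring) \<noteq> - 1"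
proof
  assume "(1::'p mod_ring) = - 1"
  hence "(of_nat 2 :: 'p mod_ring) = 0" by (metis add.right_inverse of_nat_1 of_nat_add one_add_one)
  hence "CARD('p) dvd 2" by (rule of_nat_0_mod_ring_dvd)
  moreover have "CARD('p) \<noteq> 1" "CARD('p) \<noteq> 2"
    using prime_card[where ?'a = 'p] odd_card[where ?'a = 'p] by auto
  ultimately show False using primes_dvd_imp_eq[OF prime_card two_is_prime_nat] by blast
qed

lemma least_nonresidue_nonsquare:
  "(y::'p::odd_prime_card mod_ring)\<^sup>2 \<noteq> of_nat (least_nonresidue CARD('p))"
proof -
  have "\<not> inj (\<lambda>y::'p mod_ring. y\<^sup>2)"
    using one_neq_minus_one[where ?'p = 'p] by (metis injD power2_minus)
  hence "\<not> surj (\<lambda>y::'p mod_ring. y\<^sup>2)" using finite_UNIV_surj_inj[OF finite] by blast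
  then obtain x :: "'p mod_ring" where x: "\<And>y. y\<^sup>2 \<noteq> x" by (metis surjI)
  obtain n where "x = of_nat n" using surj_of_nat_mod_ring by blast
  hence "\<not> QuadRes (int CARD('p)) (int n)" using x QuadRes_of_nat_iff by blast
  hence "\<not> QuadRes (int CARD('p)) (int (least_nonresidue CARD('p)))"
    unfolding least_nonresidue_def by (rule LeastI)
  thus ?thesis using QuadRes_of_nat_iff by blast
qed

text \<open>
  The quadratic extension obtained by adjoining a square root of the least non-residue;
  \<open>Quad a b\<close> stands for \<open>a + b * sqrt_alpha\<close>.
\<close>

datatype ('p::odd_prime_card) quad_ext = Quad (rat_part: "'p mod_ring") (irr_part: "'p mod_ring")

abbreviation alpha :: "'p::odd_prime_card mod_ring" where
  "alpha \<equiv> of_nat (least_nonresidue CARD('p))"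

instantiation quad_ext :: (odd_prime_card) field
begin

definition "0 = Quad 0 0"
definition "1 = Quad 1 0"
definition "x + y = Quad (rat_part x + rat_part y) (irr_part x + irr_part y)"
definition "- x = Quad (- rat_part x) (- irr_part x)"
definition "x - y = Quad (rat_part x - rat_part y) (irr_part x - irr_part y)"
definition "x * y =
  Quad (rat_part x * rat_part y + alpha * (irr_part x * irr_part y))
       (rat_part x * irr_part y + irr_part x * rat_part y)"
definition "inverse x =
  (let n = (rat_part x)\<^sup>2 - alpha * (irr_part x)\<^sup>2
   in Quad (rat_part x / n) (- irr_part x / n))"
definition "(x :: 'a quad_ext) div y = x * inverse y"

instance
proof
  fix x :: "'a quad_ext"
  assume "x \<noteq> 0"
  define n where "n = (rat_part x)\<^sup>2 - alpha * (irr_part x)\<^sup>2"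
  have "n \<noteq> 0"
  proof
    assume n: "n = 0"
    show False
    proof (cases "irr_part x = 0")
      case True
      with n \<open>x \<noteq> 0\<close> show False by (cases x) (auto simp: n_def zero_quad_ext_def)
    next
      case False
      hence "(rat_part x / irr_part x)\<^sup>2 = alpha"
        using n by (simp add: n_def power_divide field_simps)
      thus False using least_nonresidue_nonsquare by blast
    qed
  qed
  have "rat_part x / n * rat_part x + alpha * (- irr_part x / n * irr_part x) = n / n"
    by (subst (3) n_def) (simp add: power2_eq_square diff_divide_distrib)
  moreover have "inverse x = Quad (rat_part x / n) (- irr_part x / n)"
    by (simp add: inverse_quad_ext_def Let_def n_def)
  ultimately show "inverse x * x = 1"
    using \<open>n \<noteq> 0\<close> by (simp add: times_quad_ext_def one_quad_ext_def)
qed (auto simp: zero_quad_ext_def one_quad_ext_def plus_quad_ext_def uminus_quad_ext_def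
       minus_quad_ext_def times_quad_ext_def inverse_quad_ext_def divide_quad_ext_def
       algebra_simps quad_ext.expand)

end

definition of_base :: "'p::odd_prime_card mod_ring \<Rightarrow> 'p quad_ext" where
  "of_base a = Quad a 0"

definition sqrt_alpha :: "'p::odd_prime_card quad_ext" where
  "sqrt_alpha = Quad 0 1"

lemma sqrt_alpha_squared: "(sqrt_alpha :: 'p::odd_prime_card quad_ext)\<^sup>2 = of_base alpha"
  by (simp add: sqrt_alpha_def of_base_def power2_eq_square times_quad_ext_def)

lemma Quad_eq: "Quad a b = of_base a + of_base b * sqrt_alpha"
  by (simp add: sqrt_alpha_def of_base_def plus_quad_ext_def times_quad_ext_def)

lemma of_base_hom:
  "of_base 0 = 0" "of_base 1 = 1" "of_base (a + b) = of_base a + of_base b"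
  "of_base (a * b) = of_base a * of_base b" "of_base a = of_base b \<longleftrightarrow> a = b"
  by (simp_all add: of_base_def zero_quad_ext_def one_quad_ext_def plus_quad_ext_def
      times_quad_ext_def)

type_synonym 'p point = "'p quad_ext \<times> 'p quad_ext"

text \<open>
  A side length is determined only up to sign, hence a relation.  It is required to be non-zero,
  so two points with a side length are automatically distinct, whereas distinct points at
  squared distance \<open>0\<close> have no side length.
\<close>

definition side_length ::
    "'p::odd_prime_card point \<Rightarrow> 'p point \<Rightarrow> 'p mod_ring \<Rightarrow> bool" where
  "side_length v w d \<longleftrightarrow>
     d \<noteq> 0 \<and> (fst v - fst w)\<^sup>2 + (snd v - snd w)\<^sup>2 = of_base (d\<^sup>2)"

definition integral_point_set :: "'p::odd_prime_card point set \<Rightarrow> bool" where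
  "integral_point_set P \<longleftrightarrow> (\<forall>v\<in>P. \<forall>w\<in>P. v \<noteq> w \<longrightarrow> (\<exists>d. side_length v w d))"

definition triangle_sides ::
    "'p::odd_prime_card point \<Rightarrow> 'p point \<Rightarrow> 'p point
      \<Rightarrow> 'p mod_ring \<Rightarrow> 'p mod_ring \<Rightarrow> 'p mod_ring \<Rightarrow> bool" where
  "triangle_sides v1 v2 v3 a b c \<longleftrightarrow>
     side_length v2 v3 a \<and> side_length v1 v3 b \<and> side_length v1 v2 c"

definition V_squared ::
    "'p::odd_prime_card mod_ring \<Rightarrow> 'p mod_ring \<Rightarrow> 'p mod_ring \<Rightarrow> 'p mod_ring" where
  "V_squared a b c = (a + b + c) * (a + b - c) * (a - b + c) * (- a + b + c)"

text \<open>Only meaningful for non-degenerate triangles, that is, if \<open>V_squared a b c \<noteq> 0\<close>.\<close>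

definition characteristic ::
    "'p::odd_prime_card mod_ring \<Rightarrow> 'p mod_ring \<Rightarrow> 'p mod_ring \<Rightarrow> nat" where
  "characteristic a b c =
     (if quad_res (V_squared a b c) then 1 else least_nonresidue CARD('p))"

end

(*
  Let D be the determinant spanned by a triangle, so that V^2 = (2 D)^2 in K.  For two triangles
  spanned by u, w and u', w' the Cauchy-Binet identity gives
  D D' = (u . u') (w . w') - (u . w') (w . u').  By polarisation twice each inner product of
  differences of points of P is a sum of signed squared distances, hence lies in the prime field.
  So V^2 V'^2 = (4 D D')^2 is the square of an element of the prime field.
*)
theory Submission
  imports Defs
begin

lemma of_base_diff: "of_base (a - b) = of_base a - of_base b"
  by (simp add: of_base_def minus_quad_ext_def)

lemma of_base_power: "of_base (a ^ n) = of_base a ^ n"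
  by (induction n) (simp_all add: of_base_hom)

lemma of_base_numeral: "of_base (numeral n) = numeral n"
  by (induction n) (simp_all only: numeral.simps of_base_hom)

definition sq_dist :: "'p::odd_prime_card point \<Rightarrow> 'p point \<Rightarrow> 'p quad_ext" where
  "sq_dist v w = (fst v - fst w)\<^sup>2 + (snd v - snd w)\<^sup>2"

definition triangle_det ::
    "'p::odd_prime_card point \<Rightarrow> 'p point \<Rightarrow> 'p point \<Rightarrow> 'p quad_ext" where
  "triangle_det v1 v2 v3 =
     (fst v2 - fst v1) * (snd v3 - snd v1) - (fst v3 - fst v1) * (snd v2 - snd v1)"

text \<open>Polarised form of 2 (w - v) . (w' - v'). Using only squared distances makes it evident
  that the value lies in the prime field when the points belong to an integral point set.\<close>

definition twice_dot ::
    "'p::odd_prime_card point \<Rightarrow> 'p point \<Rightarrow> 'p point \<Rightarrow> 'p point \<Rightarrow> 'p quad_ext" where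
  "twice_dot v w v' w' = sq_dist v w' + sq_dist w v' - sq_dist v v' - sq_dist w w'"

lemma twice_dot_eq:
  "twice_dot v w v' w' =
     2 * ((fst w - fst v) * (fst w' - fst v') + (snd w - snd v) * (snd w' - snd v'))"
  unfolding twice_dot_def sq_dist_def by (simp add: algebra_simps power2_eq_square)

text \<open>Cauchy-Binet for the edge vectors at \<open>v1\<close> and \<open>v1'\<close>; the
  factor 4 comes from doubling each inner product.\<close>

lemma four_triangle_det_mult:
  "4 * (triangle_det v1 v2 v3 * triangle_det v1' v2' v3') =
     twice_dot v1 v2 v1' v2' * twice_dot v1 v3 v1' v3' -
     twice_dot v1 v2 v1' v3' * twice_dot v1 v3 v1' v2'"
  unfolding twice_dot_eq triangle_det_def by (simp add: algebra_simps power2_eq_square)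

text \<open>Heron's formula: both sides are four times the Gram determinant of the edge vectors at
  \<open>v1\<close>.\<close>

lemma of_base_V_squared:
  assumes "triangle_sides v1 v2 v3 a b c"
  shows "of_base (V_squared a b c) = (2 * triangle_det v1 v2 v3)\<^sup>2"
proof -
  have d: "sq_dist v2 v3 = of_base (a\<^sup>2)" "sq_dist v1 v3 = of_base (b\<^sup>2)"
    "sq_dist v1 v2 = of_base (c\<^sup>2)"
    using assms by (simp_all add: triangle_sides_def side_length_def sq_dist_def)
  \<comment> \<open>By the law of cosines, the last bracket is twice the inner product of the edge
    vectors at \<open>v1\<close>. Only squares of the sides remain, so they can be replaced by
    squared distances.\<close>
  have "V_squared a b c = 4 * b\<^sup>2 * c\<^sup>2 - (b\<^sup>2 + c\<^sup>2 - a\<^sup>2)\<^sup>2"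
    unfolding V_squared_def by (simp add: algebra_simps power2_eq_square)
  hence "of_base (V_squared a b c) =
      4 * sq_dist v1 v3 * sq_dist v1 v2 - (sq_dist v1 v3 + sq_dist v1 v2 - sq_dist v2 v3)\<^sup>2"
    by (simp add: d of_base_hom of_base_diff of_base_power of_base_numeral)
  \<comment> \<open>Lagrange's identity in the plane.\<close>
  also have "\<dots> = (2 * triangle_det v1 v2 v3)\<^sup>2"
    unfolding sq_dist_def triangle_det_def by (simp add: algebra_simps power2_eq_square)
  finally show ?thesis .
qed

text \<open>Coinciding points have no \<open>side_length\<close> and form a separate case; it occurs
  when the two triangles share a vertex.\<close>

lemma sq_dist_in_range:
  assumes "integral_point_set P" "v \<in> P" "w \<in> P"
  shows "sq_dist v w \<in> range of_base"
proof (cases "v = w")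
  case True
  hence "sq_dist v w = of_base 0" by (simp add: sq_dist_def of_base_hom)
  thus ?thesis by blast
next
  case False
  then obtain d where "sq_dist v w = of_base (d\<^sup>2)"
    using assms by (auto simp: integral_point_set_def side_length_def sq_dist_def)
  thus ?thesis by blast
qed

lemma range_of_base_closed:
  assumes "x \<in> range of_base" "y \<in> range of_base"
  shows "x + y \<in> range of_base" "x - y \<in> range of_base" "x * y \<in> range of_base"
  using assms by (auto simp flip: of_base_hom of_base_diff)

lemma twice_dot_in_range:
  assumes "integral_point_set P" "v \<in> P" "w \<in> P" "v' \<in> P" "w' \<in> P"
  shows "twice_dot v w v' w' \<in> range of_base"
  unfolding twice_dot_def using assms by (intro range_of_base_closed sq_dist_in_range)

text \<open>The quotient of two squares is a square, and \<open>x\<close> can be divided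
  out.\<close>

lemma quad_res_cong_mult:
  fixes x y :: "'p::odd_prime_card mod_ring"
  assumes "x * y = r\<^sup>2" "x \<noteq> 0" "quad_res x"
  shows "quad_res y"
proof -
  obtain s where s: "s\<^sup>2 = x" using assms quad_res_iff by blast
  hence "(r / s)\<^sup>2 = y" using assms by (simp add: power_divide field_simps)
  thus ?thesis using quad_res_iff by blast
qed

theorem theorem7:
  fixes P :: "'p::odd_prime_card point set"
    and v1 v2 v3 v1' v2' v3' :: "'p point"
    and a b c a' b' c' :: "'p mod_ring"
  assumes "integral_point_set P"
    and "{v1, v2, v3} \<subseteq> P" and "{v1', v2', v3'} \<subseteq> P"
    and "triangle_sides v1 v2 v3 a b c" and "triangle_sides v1' v2' v3' a' b' c'"
    and "V_squared a b c \<noteq> 0" and "V_squared a' b' c' \<noteq> 0"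
  shows "characteristic a b c = characteristic a' b' c' \<and>
         (quad_res (V_squared a b c) \<longleftrightarrow> quad_res (V_squared a' b' c'))"
proof -
  \<comment> \<open>A single determinant may lie outside the prime field, namely when its
    \<open>V_squared\<close> is a non-residue; the product never does.\<close>
  have "4 * (triangle_det v1 v2 v3 * triangle_det v1' v2' v3') \<in> range of_base"
    unfolding four_triangle_det_mult using assms(1-3)
    by (intro range_of_base_closed twice_dot_in_range) auto
  then obtain r where r: "4 * (triangle_det v1 v2 v3 * triangle_det v1' v2' v3') = of_base r"
    by blast
  have "of_base (V_squared a b c * V_squared a' b' c') =
      (2 * triangle_det v1 v2 v3)\<^sup>2 * (2 * triangle_det v1' v2' v3')\<^sup>2"
    using assms(4,5) by (simp add: of_base_hom of_base_V_squared)
  also have "\<dots> = (4 * (triangle_det v1 v2 v3 * triangle_det v1' v2' v3'))\<^sup>2"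
    by (simp add: algebra_simps power2_eq_square)
  also have "\<dots> = of_base (r\<^sup>2)"
    by (simp only: r of_base_power)
  \<comment> \<open>Injectivity of \<open>of_base\<close> brings the identity down to the prime
    field.\<close>
  finally have "V_squared a b c * V_squared a' b' c' = r\<^sup>2"
    by (simp only: of_base_hom(5))
  hence "quad_res (V_squared a b c) \<longleftrightarrow> quad_res (V_squared a' b' c')"
    using assms(6,7) quad_res_cong_mult[of "V_squared a b c"]
      quad_res_cong_mult[of "V_squared a' b' c'"] by (auto simp: mult.commute)
  thus ?thesis by (simp add: characteristic_def)
qed

end
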